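(* Let $n\ge1$. The orbits of the action $P\cdot M=\overline{\overline{P}M}$ of $H_n$ on $\mathcal{C}(G_n)$ partition $\mathcal{C}(G_n)$ into subsets each of cardinality $|H_n|=2^n\cdot n!$; consequently the number of orbits is $|\mathcal{C}(G_n)|/(2^n\cdot n!)$.
   Context: Let $Q_n=\{1,\dots,n\}$. A preference matrix on $Q_n$ is a $2^n\times n$ $0/1$ matrix whose rows are exactly the $2^n$ elements of $\{0,1\}^n$, each once. $\mathcal{C}(G_n)$ is the set of preference matrices on $Q_n$ in which consecutive rows differ in exactly one coordinate. $H_n$ is the group of $n\times n$ matrices with entries in $\{0,\pm1\}$ having exactly one nonzero entry in each row and column. For a matrix with entries in $\{0,\pm1\}$, $\overline{P}$ replaces each $0$ by $-1$ and each $-1$ by $0$; $P\cdot M=\overline{\overline{P}M}$ is a right action of $H_n$ on $\mathcal{C}(G_n)$. *)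

theory Defs
  imports
    "HOL-Algebra.Group_Action"
    "HOL-Library.Disjoint_Sets"
    "Jordan_Normal_Form.Matrix"
begin

text \<open>
  Matrices are integer matrices, so columns are indexed by \<open>0, \<dots>, n - 1\<close> instead of
  \<open>1, \<dots>, n\<close>, and rows by \<open>0, \<dots>, 2 ^ n - 1\<close>.
\<close>

definition binary_vecs :: "nat \<Rightarrow> int vec set" where
  "binary_vecs n = {v \<in> carrier_vec n. \<forall>j<n. v $ j \<in> {0, 1}}"

definition preference_mats :: "nat \<Rightarrow> int mat set" where
  "preference_mats n =
    {P \<in> carrier_mat (2 ^ n) n. distinct (rows P) \<and> set (rows P) = binary_vecs n}"

text \<open>
  Only the pairs \<open>r, r + 1\<close> with \<open>r + 1 < 2 ^ n\<close> count as consecutive: there is no condition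
  relating the last row to the first.
\<close>

definition gray_mats :: "nat \<Rightarrow> int mat set" where
  "gray_mats n =
    {P \<in> preference_mats n. \<forall>r. Suc r < 2 ^ n \<longrightarrow>
       card {j. j < n \<and> P $$ (r, j) \<noteq> P $$ (Suc r, j)} = 1}"

definition signed_perm_mats :: "nat \<Rightarrow> int mat set" where
  "signed_perm_mats n =
    {M \<in> carrier_mat n n.
       (\<forall>i<n. \<forall>j<n. M $$ (i, j) \<in> {-1, 0, 1}) \<and>
       (\<forall>i<n. \<exists>!j. j < n \<and> M $$ (i, j) \<noteq> 0) \<and>
       (\<forall>j<n. \<exists>!i. i < n \<and> M $$ (i, j) \<noteq> 0)}"

definition signed_perm_group :: "nat \<Rightarrow> int mat monoid" where
  "signed_perm_group n = \<lparr>carrier = signed_perm_mats n, monoid.mult = (*), one = 1\<^sub>m n\<rparr>"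

definition bar :: "int mat \<Rightarrow> int mat" where
  "bar P = map_mat (\<lambda>x. if x = 0 then -1 else if x = -1 then 0 else x) P"

definition act :: "int mat \<Rightarrow> int mat \<Rightarrow> int mat" where
  "act P M = bar (bar P * M)"

text \<open>
  \<^const>\<open>orbits\<close> takes the group element as the first argument of the action; \<open>act\<close> is a right
  action, hence the swapped arguments.
\<close>

definition gray_orbits :: "nat \<Rightarrow> int mat set set" where
  "gray_orbits n = orbits (signed_perm_group n) (gray_mats n) (\<lambda>M P. act P M)"


lemma signed_perm_mats_iff:
  "M \<in> signed_perm_mats n \<longleftrightarrow>
    (\<exists>\<tau> s. bij_betw \<tau> {..<n} {..<n} \<and> (\<forall>j<n. s j \<in> {-1, 1}) \<and>
      M = mat n n (\<lambda>(i, j). if i = \<tau> j then s j else 0))"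
proof
  assume M: "M \<in> signed_perm_mats n"
  hence c: "M \<in> carrier_mat n n" and e: "\<And>i j. i < n \<Longrightarrow> j < n \<Longrightarrow> M $$ (i, j) \<in> {-1, 0, 1}"
    and r: "\<And>i. i < n \<Longrightarrow> \<exists>!j. j < n \<and> M $$ (i, j) \<noteq> 0"
    and k: "\<And>j. j < n \<Longrightarrow> \<exists>!i. i < n \<and> M $$ (i, j) \<noteq> 0"
    by (auto simp: signed_perm_mats_def)
  define \<tau> where "\<tau> j = (THE i. i < n \<and> M $$ (i, j) \<noteq> 0)" for j
  have t: "\<tau> j < n \<and> M $$ (\<tau> j, j) \<noteq> 0" if "j < n" for j
    unfolding \<tau>_def using theI'[OF k[OF that]] .
  have inj: "inj_on \<tau> {..<n}"
    using t r by (intro inj_onI) (metis lessThan_iff)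
  have "\<tau> ` {..<n} = {..<n}"
    using inj t by (intro endo_inj_surj) auto
  hence b: "bij_betw \<tau> {..<n} {..<n}" using inj by (simp add: bij_betw_def)
  have "M = mat n n (\<lambda>(i, j). if i = \<tau> j then M $$ (\<tau> j, j) else 0)"
  proof (rule eq_matI)
    fix i j
    assume "i < dim_row (mat n n (\<lambda>(i, j). if i = \<tau> j then M $$ (\<tau> j, j) else 0))"
      "j < dim_col (mat n n (\<lambda>(i, j). if i = \<tau> j then M $$ (\<tau> j, j) else 0))"
    hence ij: "i < n" "j < n" by auto
    thus "M $$ (i, j) = mat n n (\<lambda>(i, j). if i = \<tau> j then M $$ (\<tau> j, j) else 0) $$ (i, j)"
      using t[of j] k[of j] by auto
  qed (use c in auto)
  moreover have "\<forall>j<n. M $$ (\<tau> j, j) \<in> {-1, 1}" using t e by fastforce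
  ultimately show "\<exists>\<tau> s. bij_betw \<tau> {..<n} {..<n} \<and> (\<forall>j<n. s j \<in> {-1, 1}) \<and>
      M = mat n n (\<lambda>(i, j). if i = \<tau> j then s j else 0)"
    using b by (intro exI[of _ \<tau>] exI[of _ "\<lambda>j. M $$ (\<tau> j, j)"]) auto
next
  assume "\<exists>\<tau> s. bij_betw \<tau> {..<n} {..<n} \<and> (\<forall>j<n. s j \<in> {-1, 1}) \<and>
      M = mat n n (\<lambda>(i, j). if i = \<tau> j then s j else 0)"
  then obtain \<tau> s where b: "bij_betw \<tau> {..<n} {..<n}" and s: "\<And>j. j < n \<Longrightarrow> s j \<in> {-1, 1::int}"
    and M: "M = mat n n (\<lambda>(i, j). if i = \<tau> j then s j else 0)" by blast
  have ne: "s j \<noteq> 0" if "j < n" for j using s[OF that] by auto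
  have lt: "\<tau> j < n" if "j < n" for j using b that by (auto simp: bij_betw_def)
  have nz: "M $$ (i, j) \<noteq> 0 \<longleftrightarrow> i = \<tau> j" if "i < n" "j < n" for i j
    using that ne by (simp add: M)
  have "\<exists>!j. j < n \<and> M $$ (i, j) \<noteq> 0" if i: "i < n" for i
  proof -
    have "i \<in> \<tau> ` {..<n}" using b i by (simp add: bij_betw_def)
    then obtain j where "j < n" "i = \<tau> j" by auto
    moreover have "j' = j" if "j' < n" "j < n" "\<tau> j' = \<tau> j" for j'
      using that b by (auto simp: bij_betw_def inj_on_def)
    ultimately show ?thesis using nz[OF i] by metis
  qed
  moreover have "\<exists>!i. i < n \<and> M $$ (i, j) \<noteq> 0" if "j < n" for j
    using nz[OF _ that] lt[OF that] by metis
  moreover have "M $$ (i, j) \<in> {-1, 0, 1}" if "i < n" "j < n" for i j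
    using that s[OF that(2)] by (auto simp: M)
  ultimately show "M \<in> signed_perm_mats n" by (simp add: signed_perm_mats_def M)
qed

lemma signed_perm_matsE:
  assumes "M \<in> signed_perm_mats n"
  obtains \<tau> s where "bij_betw \<tau> {..<n} {..<n}" "\<forall>j<n. s j \<in> {-1, 1}"
    "\<forall>j<n. \<tau> j < n" "M = mat n n (\<lambda>(i, j). if i = \<tau> j then s j else 0)"
  using assms unfolding signed_perm_mats_iff bij_betw_def by blast

lemma mult_signed_perm_index:
  assumes A: "A \<in> carrier_mat m n" and M: "M = mat n n (\<lambda>(i, j). if i = \<tau> j then s j else 0)"
    and "r < m" "j < n" "\<tau> j < n"
  shows "(A * M) $$ (r, j) = A $$ (r, \<tau> j) * (s j :: int)"
proof -
  have "(A * M) $$ (r, j) = (\<Sum>i = 0..<n. A $$ (r, i) * (if i = \<tau> j then s j else 0))"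
    using assms by (simp add: scalar_prod_def)
  also have "\<dots> = (\<Sum>i = 0..<n. if i = \<tau> j then A $$ (r, i) * s j else 0)"
    by (intro sum.cong) auto
  also have "\<dots> = A $$ (r, \<tau> j) * s j"
    using assms by simp
  finally show ?thesis .
qed

lemma group_signed_perm_group: "group (signed_perm_group n)"
proof (rule groupI)
  fix M N assume "M \<in> carrier (signed_perm_group n)" "N \<in> carrier (signed_perm_group n)"
  hence M: "M \<in> signed_perm_mats n" and N: "N \<in> signed_perm_mats n"
    by (auto simp: signed_perm_group_def)
  have cM: "M \<in> carrier_mat n n" using M by (simp add: signed_perm_mats_def)
  obtain \<tau> s where t': "bij_betw \<tau> {..<n} {..<n}" "\<forall>j<n. s j \<in> {-1, 1}"
    "\<forall>j<n. \<tau> j < n" "M = mat n n (\<lambda>(i, j). if i = \<tau> j then s j else 0)"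
    using M by (rule signed_perm_matsE)
  note t = t'(1) t'(2,3)[rule_format] t'(4)
  obtain \<rho> u where u': "bij_betw \<rho> {..<n} {..<n}" "\<forall>j<n. u j \<in> {-1, 1}"
    "\<forall>j<n. \<rho> j < n" "N = mat n n (\<lambda>(i, j). if i = \<rho> j then u j else 0)"
    using N by (rule signed_perm_matsE)
  note u = u'(1) u'(2,3)[rule_format] u'(4)
  have "M * N = mat n n (\<lambda>(i, j). if i = (\<tau> \<circ> \<rho>) j then s (\<rho> j) * u j else 0)"
    (is "_ = ?R")
  proof (rule eq_matI)
    fix i j assume "i < dim_row ?R" "j < dim_col ?R"
    hence ij: "i < n" "j < n" by auto
    show "(M * N) $$ (i, j) = ?R $$ (i, j)"
      using mult_signed_perm_index[OF cM u(4) ij u(3)[OF ij(2)]] ij u(3)[OF ij(2)]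
      by (simp add: t(4))
  qed (auto simp: t(4) u(4))
  moreover have "\<forall>j<n. s (\<rho> j) * u j \<in> {-1, 1}" using t(2) u(2,3) by fastforce
  ultimately have "M * N \<in> signed_perm_mats n"
    unfolding signed_perm_mats_iff using bij_betw_trans[OF u(1) t(1)]
    by (intro exI[of _ "\<tau> \<circ> \<rho>"] exI[of _ "\<lambda>j. s (\<rho> j) * u j"] conjI)
  thus "M \<otimes>\<^bsub>signed_perm_group n\<^esub> N \<in> carrier (signed_perm_group n)"
    by (simp add: signed_perm_group_def)
next
  show "\<one>\<^bsub>signed_perm_group n\<^esub> \<in> carrier (signed_perm_group n)"
    by (auto simp: signed_perm_group_def signed_perm_mats_def split: if_splits)
next
  fix L M N
  assume "L \<in> carrier (signed_perm_group n)" "M \<in> carrier (signed_perm_group n)"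
    "N \<in> carrier (signed_perm_group n)"
  thus "L \<otimes>\<^bsub>signed_perm_group n\<^esub> M \<otimes>\<^bsub>signed_perm_group n\<^esub> N =
      L \<otimes>\<^bsub>signed_perm_group n\<^esub> (M \<otimes>\<^bsub>signed_perm_group n\<^esub> N)"
    by (auto simp: signed_perm_group_def signed_perm_mats_def)
next
  fix M assume "M \<in> carrier (signed_perm_group n)"
  thus "\<one>\<^bsub>signed_perm_group n\<^esub> \<otimes>\<^bsub>signed_perm_group n\<^esub> M = M"
    by (auto simp: signed_perm_group_def signed_perm_mats_def)
next
  fix M assume "M \<in> carrier (signed_perm_group n)"
  hence M: "M \<in> signed_perm_mats n" by (simp add: signed_perm_group_def)
  hence cM: "M \<in> carrier_mat n n" by (simp add: signed_perm_mats_def)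
  obtain \<tau> s where t': "bij_betw \<tau> {..<n} {..<n}" "\<forall>j<n. s j \<in> {-1, 1}"
    "\<forall>j<n. \<tau> j < n" "M = mat n n (\<lambda>(i, j). if i = \<tau> j then s j else 0)"
    using M by (rule signed_perm_matsE)
  note t = t'(1) t'(2,3)[rule_format] t'(4)
  have "transpose_mat M * M = 1\<^sub>m n"
  proof (rule eq_matI)
    fix i j assume "i < dim_row (1\<^sub>m n)" "j < dim_col (1\<^sub>m n)"
    hence ij: "i < n" "j < n" by auto
    have "i = j" if "\<tau> j = \<tau> i" using that t(1) ij by (auto simp: bij_betw_def inj_on_def)
    moreover have "s j * s j = 1" using t(2)[OF ij(2)] by auto
    moreover have "(transpose_mat M * M) $$ (i, j) = transpose_mat M $$ (i, \<tau> j) * s j"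
      using mult_signed_perm_index[of "transpose_mat M" n n M \<tau> s i j] ij t cM by simp
    ultimately show "(transpose_mat M * M) $$ (i, j) = 1\<^sub>m n $$ (i, j)"
      using ij t(3)[OF ij(2)] by (auto simp: t(4))
  qed (use cM in auto)
  moreover have "transpose_mat M \<in> signed_perm_mats n"
  proof -
    have T: "transpose_mat M $$ (i, j) = M $$ (j, i)" if "i < n" "j < n" for i j
      using that cM by simp
    have "(\<exists>!j. j < n \<and> transpose_mat M $$ (i, j) \<noteq> 0) \<longleftrightarrow> (\<exists>!j. j < n \<and> M $$ (j, i) \<noteq> 0)"
      "(\<exists>!j. j < n \<and> transpose_mat M $$ (j, i) \<noteq> 0) \<longleftrightarrow> (\<exists>!j. j < n \<and> M $$ (i, j) \<noteq> 0)"
      if "i < n" for i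
      using T that by (simp_all cong: conj_cong)
    thus ?thesis using M T by (simp add: signed_perm_mats_def)
  qed
  ultimately show "\<exists>N\<in>carrier (signed_perm_group n). N \<otimes>\<^bsub>signed_perm_group n\<^esub> M =
      \<one>\<^bsub>signed_perm_group n\<^esub>"
    by (auto simp: signed_perm_group_def)
qed

lemma bar_bar [simp]: "bar (bar P) = P"
  by (rule eq_matI) (auto simp: bar_def)

lemma bar_carrier [simp]: "bar P \<in> carrier_mat m n \<longleftrightarrow> P \<in> carrier_mat m n"
  by (simp add: bar_def)

lemma act_one: "P \<in> gray_mats n \<Longrightarrow> act P \<one>\<^bsub>signed_perm_group n\<^esub> = P"
proof -
  assume "P \<in> gray_mats n"
  hence "bar P \<in> carrier_mat (2 ^ n) n" by (simp add: gray_mats_def preference_mats_def)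
  thus ?thesis by (simp add: act_def signed_perm_group_def)
qed

lemma act_mult:
  assumes "P \<in> gray_mats n" "M \<in> carrier (signed_perm_group n)" "N \<in> carrier (signed_perm_group n)"
  shows "act P (M \<otimes>\<^bsub>signed_perm_group n\<^esub> N) = act (act P M) N"
proof -
  have "bar P \<in> carrier_mat (2 ^ n) n" "M \<in> carrier_mat n n" "N \<in> carrier_mat n n"
    using assms
    by (auto simp: gray_mats_def preference_mats_def signed_perm_group_def signed_perm_mats_def)
  thus ?thesis by (simp add: act_def signed_perm_group_def)
qed

lemma act_closed:
  assumes P: "P \<in> gray_mats n" and "M \<in> carrier (signed_perm_group n)"
  shows "act P M \<in> gray_mats n"
proof -
  have M: "M \<in> signed_perm_mats n" using assms by (simp add: signed_perm_group_def)
  have cP: "P \<in> carrier_mat (2 ^ n) n" and cM: "M \<in> carrier_mat n n" and dP: "distinct (rows P)"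
    and sP: "set (rows P) = binary_vecs n"
    using P M by (auto simp: gray_mats_def preference_mats_def signed_perm_mats_def)
  obtain \<tau> s where t': "bij_betw \<tau> {..<n} {..<n}" "\<forall>j<n. s j \<in> {-1, 1}"
    "\<forall>j<n. \<tau> j < n" "M = mat n n (\<lambda>(i, j). if i = \<tau> j then s j else 0)"
    using M by (rule signed_perm_matsE)
  note t = t'(1) t'(2,3)[rule_format] t'(4)
  have cA: "act P M \<in> carrier_mat (2 ^ n) n" using cP cM by (auto simp: act_def bar_def)
  have bin: "P $$ (r, j) \<in> {0, 1}" if "r < 2 ^ n" "j < n" for r j
  proof -
    have "row P r \<in> binary_vecs n" using sP that cP by (auto simp: rows_def)
    hence "row P r $ j \<in> {0, 1}" using that by (simp only: binary_vecs_def) auto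
    thus ?thesis using that cP by auto
  qed
  have ix: "act P M $$ (r, j) = (if s j = 1 then P $$ (r, \<tau> j) else 1 - P $$ (r, \<tau> j))"
    if rj: "r < 2 ^ n" "j < n" for r j
  proof -
    have "(bar P * M) $$ (r, j) = bar P $$ (r, \<tau> j) * s j"
      by (rule mult_signed_perm_index[OF _ t(4) rj t(3)[OF rj(2)]]) (use cP in simp)
    moreover have "act P M $$ (r, j) = (let x = (bar P * M) $$ (r, j) in
        if x = 0 then -1 else if x = -1 then 0 else x)"
      unfolding act_def bar_def[of "bar P * M"] using rj cP cM by (simp add: Let_def bar_def)
    ultimately show ?thesis
      using bin[OF rj(1) t(3)[OF rj(2)]] t(2)[OF rj(2)] rj cP t(3)[OF rj(2)]
      by (auto simp: bar_def)
  qed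
  have inv: "\<exists>j<n. i = \<tau> j" if "i < n" for i
  proof -
    have "i \<in> \<tau> ` {..<n}" using t(1) that by (simp add: bij_betw_def)
    thus ?thesis by auto
  qed
  have dist: "distinct (rows (act P M))"
    unfolding distinct_conv_nth
  proof (intro allI impI)
    fix a b assume "a < length (rows (act P M))" "b < length (rows (act P M))" "a \<noteq> b"
    hence ab: "a < 2 ^ n" "b < 2 ^ n" "a \<noteq> b" using cA by auto
    have "row P a \<noteq> row P b"
      using dP ab cP by (simp add: distinct_conv_nth)
    moreover have "row P a = row P b" if "\<forall>i<n. P $$ (a, i) = P $$ (b, i)"
      by (rule eq_vecI) (use that ab cP in auto)
    ultimately obtain i where i: "i < n" "P $$ (a, i) \<noteq> P $$ (b, i)" by blast
    then obtain j where "j < n" "i = \<tau> j" using inv by blast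
    hence "j < n" "act P M $$ (a, j) \<noteq> act P M $$ (b, j)" using i ab ix by simp_all
    hence "row (act P M) a $ j \<noteq> row (act P M) b $ j" using cA ab by simp
    hence "row (act P M) a \<noteq> row (act P M) b" by metis
    thus "rows (act P M) ! a \<noteq> rows (act P M) ! b" using ab cA by simp
  qed
  have set: "set (rows (act P M)) = binary_vecs n"
  proof
    show "set (rows (act P M)) \<subseteq> binary_vecs n"
    proof
      fix v assume "v \<in> set (rows (act P M))"
      then obtain r where r: "r < 2 ^ n" "v = row (act P M) r" using cA by (auto simp: rows_def)
      have "v $ j \<in> {0, 1}" if "j < n" for j
        using bin[OF r(1) t(3)[OF that]] r that cA by (auto simp: ix)
      thus "v \<in> binary_vecs n" using r cA by (auto simp: binary_vecs_def)
    qed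
    show "binary_vecs n \<subseteq> set (rows (act P M))"
    proof
      fix v assume v: "v \<in> binary_vecs n"
      define g where "g = inv_into {..<n} \<tau>"
      have g: "g (\<tau> j) = j" if "j < n" for j
        using that t(1) by (simp add: g_def bij_betw_def)
      define w where "w = vec n (\<lambda>i. if s (g i) = 1 then v $ g i else 1 - v $ g i)"
      have "w $ i \<in> {0, 1}" if i: "i < n" for i
      proof -
        obtain j where "j < n" "i = \<tau> j" using inv[OF i] by blast
        moreover have "v $ j \<in> {0, 1}" using v \<open>j < n\<close> by (simp only: binary_vecs_def) auto
        ultimately show ?thesis using i g by (auto simp: w_def)
      qed
      hence "w \<in> binary_vecs n" by (simp only: binary_vecs_def) (auto simp: w_def)
      hence "w \<in> row P ` {0..<2 ^ n}" using sP cP by (simp add: rows_def)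
      then obtain r where r: "r < 2 ^ n" "w = row P r" by auto
      have "v = row (act P M) r"
      proof (rule eq_vecI)
        show "dim_vec v = dim_vec (row (act P M) r)" using v cA by (auto simp: binary_vecs_def)
        fix j assume "j < dim_vec (row (act P M) r)"
        hence j: "j < n" using cA by simp
        have "P $$ (r, \<tau> j) = w $ \<tau> j" using r t(3)[OF j] cP by simp
        thus "v $ j = row (act P M) r $ j"
          using ix[OF r(1) j] t(3)[OF j] g[OF j] j r(1) cA by (simp add: w_def)
      qed
      thus "v \<in> set (rows (act P M))" using r cA by (auto simp: rows_def)
    qed
  qed
  have "card {j. j < n \<and> act P M $$ (r, j) \<noteq> act P M $$ (Suc r, j)} = 1" if r: "Suc r < 2 ^ n" for r
  proof -
    let ?D = "{j. j < n \<and> act P M $$ (r, j) \<noteq> act P M $$ (Suc r, j)}"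
    have D: "?D = {j. j < n \<and> P $$ (r, \<tau> j) \<noteq> P $$ (Suc r, \<tau> j)}"
      using r by (auto simp: ix split: if_splits)
    have "\<tau> ` ?D = {i. i < n \<and> P $$ (r, i) \<noteq> P $$ (Suc r, i)}"
      unfolding D using inv t(3) by auto
    moreover have "card (\<tau> ` ?D) = card ?D"
      using t(1) by (intro card_image) (auto simp: bij_betw_def inj_on_def)
    ultimately have "card ?D = card {i. i < n \<and> P $$ (r, i) \<noteq> P $$ (Suc r, i)}"
      by simp
    thus ?thesis using P r by (simp add: gray_mats_def)
  qed
  thus ?thesis using cA dist set by (simp add: gray_mats_def preference_mats_def)
qed

end

theory Submission
  imports Defs "HOL-Combinatorics.Permutations"
begin

text \<open>
  The action is free. The rows of a preference matrix exhaust the binary vectors, so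
  \<open>bar P\<close> contains the all-ones row, and multiplying it by \<open>M\<close> reveals the signs of \<open>M\<close>; the
  rows coming from the unit vectors then reveal the underlying permutation. Hence every orbit
  is in bijection with the group, and the group has one element for each pair of a permutation
  and a sign vector.
\<close>

text \<open>Turns exhaustion of \<open>binary_vecs n\<close> by the rows into a choice principle: a
  row with any prescribed 0/1 entries can be picked. The freeness argument uses it for the all-ones
  row and for unit vectors.\<close>

lemma preference_mats_row:
  assumes P: "P \<in> preference_mats n" and f: "\<And>j. j < n \<Longrightarrow> f j \<in> {0, 1}"
  obtains r where "r < 2 ^ n" "\<And>j. j < n \<Longrightarrow> P $$ (r, j) = f j"
proof -
  have cP: "P \<in> carrier_mat (2 ^ n) n" and sP: "set (rows P) = binary_vecs n"
    using P by (auto simp: preference_mats_def)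
  have "vec n f \<in> set (rows P)"
    unfolding sP binary_vecs_def using f by auto
  then obtain r where r: "r < 2 ^ n" "vec n f = row P r"
    using cP by (auto simp: rows_def)
  have "P $$ (r, j) = f j" if "j < n" for j
  proof -
    have "row P r $ j = f j" using that by (simp flip: r(2))
    thus ?thesis using cP r(1) that by simp
  qed
  thus thesis using r(1) that by blast
qed

text \<open>If some preference matrix exists, its finite row list enumerates
  \<open>binary_vecs n\<close>. Each preference matrix is then rebuilt from its list of
  \<open>2 ^ n\<close> rows, and there are finitely many such lists.\<close>

lemma finite_preference_mats: "finite (preference_mats n)"
proof (cases "preference_mats n = {}")
  case False
  then obtain Q where "Q \<in> preference_mats n" by blast
  hence "binary_vecs n = set (rows Q)" by (simp add: preference_mats_def)
  hence fin: "finite (binary_vecs n)" by simp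
  have "P \<in> mat_of_rows n ` {xs. set xs \<subseteq> binary_vecs n \<and> length xs = 2 ^ n}"
    if "P \<in> preference_mats n" for P
    using that by (intro image_eqI[of _ _ "rows P"]) (auto simp: preference_mats_def)
  thus ?thesis
    using finite_lists_length_eq[OF fin] by (meson finite_imageI finite_subset subsetI)
qed simp

lemma act_inj_on:
  assumes P: "P \<in> preference_mats n"
  shows "inj_on (act P) (signed_perm_mats n)"
proof (rule inj_onI)
  fix M N assume MN: "M \<in> signed_perm_mats n" "N \<in> signed_perm_mats n" and eq: "act P M = act P N"
  obtain \<tau> s where t: "\<forall>j<n. \<tau> j < n" "M = mat n n (\<lambda>(i, j). if i = \<tau> j then s j else 0)"
    and s: "\<forall>j<n. s j \<in> {-1, 1}"
    using MN(1) by (rule signed_perm_matsE)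
  obtain \<rho> u where u: "\<forall>j<n. \<rho> j < n" "N = mat n n (\<lambda>(i, j). if i = \<rho> j then u j else 0)"
    using MN(2) by (rule signed_perm_matsE)
  have cP: "P \<in> carrier_mat (2 ^ n) n" using P by (simp add: preference_mats_def)
  \<comment> \<open>The outer \<open>bar\<close> is an involution, so it cancels.\<close>
  have "bar P * M = bar P * N" using eq by (metis act_def bar_bar)
  hence prod: "bar P $$ (r, \<tau> j) * s j = bar P $$ (r, \<rho> j) * u j" if "r < 2 ^ n" "j < n" for r j
    using mult_signed_perm_index[OF _ t(2) that, of "bar P"]
      mult_signed_perm_index[OF _ u(2) that, of "bar P"] t(1) u(1) cP that
    by simp
  have bar_ix: "bar P $$ (r, i) = (if P $$ (r, i) = 0 then -1 else 1)"
    if "r < 2 ^ n" "i < n" "P $$ (r, i) \<in> {0, 1}" for r i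
    using that cP by (auto simp: bar_def)
  \<comment> \<open>\<open>bar\<close> fixes 1, so row \<open>a\<close> of \<open>bar P * M\<close>
    is the sign vector \<open>s\<close>, and that of \<open>bar P * N\<close> is
    \<open>u\<close>.\<close>
  obtain a where a: "a < 2 ^ n" "\<And>j. j < n \<Longrightarrow> P $$ (a, j) = 1"
    using preference_mats_row[OF P, of "\<lambda>_. 1"] by auto
  have su: "s j = u j" if "j < n" for j
    using prod[OF a(1) that] a that t(1) u(1) by (simp add: bar_ix)
  have "\<tau> j = \<rho> j" if j: "j < n" for j
  proof -
    \<comment> \<open>The unit vector at \<open>\<tau> j\<close>: after \<open>bar\<close>, its row
      has 1 at \<open>\<tau> j\<close> and -1 elsewhere, so an equal entry at
      \<open>\<rho> j\<close> forces \<open>\<rho> j = \<tau> j\<close>.\<close>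
    define e where "e i = (if i = \<tau> j then 1 else 0 :: int)" for i
    obtain r where r: "r < 2 ^ n" "\<And>i. i < n \<Longrightarrow> P $$ (r, i) = e i"
    proof -
      have "e i \<in> {0, 1}" for i by (simp add: e_def)
      thus thesis using preference_mats_row[OF P, of e] that by metis
    qed
    have "bar P $$ (r, \<tau> j) = bar P $$ (r, \<rho> j)"
      using prod[OF r(1) j] su[OF j] s j by auto
    thus ?thesis using r j t(1) u(1) by (auto simp: bar_ix e_def split: if_splits)
  qed
  thus "M = N" using su by (auto simp: t(2) u(2))
qed

text \<open>Counts pairs of a permutation and a sign vector. Outside \<open>{..<n}\<close>,
  \<open>permutes\<close> fixes the permutation to the identity and the extensional function space
  fixes the signs to \<open>undefined\<close>, so each matrix comes from exactly one pair.\<close>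

lemma card_signed_perm_mats: "card (signed_perm_mats n) = 2 ^ n * fact n"
proof -
  define S where "S = {\<tau>. \<tau> permutes {..<n}} \<times> ({..<n} \<rightarrow>\<^sub>E {-1, 1 :: int})"
  define f :: "(nat \<Rightarrow> nat) \<times> (nat \<Rightarrow> int) \<Rightarrow> int mat"
    where "f = (\<lambda>(\<tau>, s). mat n n (\<lambda>(i, j). if i = \<tau> j then s j else 0))"
  have "inj_on f S"
  proof (rule inj_onI, clarsimp simp: S_def f_def)
    fix \<tau> s \<rho> u
    assume t: "\<tau> permutes {..<n}" and r: "\<rho> permutes {..<n}"
      and s: "s \<in> {..<n} \<rightarrow>\<^sub>E {-1, 1 :: int}" and u: "u \<in> {..<n} \<rightarrow>\<^sub>E {-1, 1 :: int}"
      and eq: "mat n n (\<lambda>(i, j). if i = \<tau> j then s j else 0) =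
        mat n n (\<lambda>(i, j). if i = \<rho> j then u j else 0)"
    have lt: "\<tau> j < n" if "j < n" for j using permutes_in_image[OF t, of j] that by simp
    have *: "\<tau> j = \<rho> j \<and> s j = u j" if j: "j < n" for j
    proof -
      have "s j \<noteq> 0" using s j by (auto dest!: PiE_mem[of _ _ _ j])
      \<comment> \<open>Compare entry \<open>(\<tau> j, j)\<close>: it is nonzero on the left, so
        the zero branch on the right is impossible.\<close>
      moreover have "s j = (if \<tau> j = \<rho> j then u j else 0)"
        using arg_cong[OF eq, of "\<lambda>M. M $$ (\<tau> j, j)"] j lt[OF j] by simp
      ultimately show ?thesis by (auto split: if_splits)
    qed
    have "\<tau> = \<rho>"
    proof
      fix j show "\<tau> j = \<rho> j"
        using * permutes_not_in[OF t, of j] permutes_not_in[OF r, of j] by (cases "j < n") auto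
    qed
    moreover have "s = u" using * by (intro PiE_ext[OF s u]) auto
    ultimately show "\<tau> = \<rho> \<and> s = u" by simp
  qed
  moreover have "f ` S = signed_perm_mats n"
  proof (intro equalityI subsetI)
    fix M assume "M \<in> f ` S"
    then obtain \<tau> s where "\<tau> permutes {..<n}" "s \<in> {..<n} \<rightarrow>\<^sub>E {-1, 1 :: int}"
      "M = mat n n (\<lambda>(i, j). if i = \<tau> j then s j else 0)"
      by (auto simp: S_def f_def)
    thus "M \<in> signed_perm_mats n"
      unfolding signed_perm_mats_iff
      by (intro exI[of _ \<tau>] exI[of _ s]) (auto simp: permutes_imp_bij dest: PiE_mem)
  next
    fix M assume "M \<in> signed_perm_mats n"
    then obtain \<tau> s where t: "bij_betw \<tau> {..<n} {..<n}" "\<forall>j<n. s j \<in> {-1, 1 :: int}"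
      "M = mat n n (\<lambda>(i, j). if i = \<tau> j then s j else 0)"
      by (rule signed_perm_matsE)
    \<comment> \<open>\<open>\<tau>\<close> is only controlled below \<open>n\<close>; extending it
      by the identity yields a genuine permutation with the same matrix.\<close>
    define \<rho> where "\<rho> j = (if j < n then \<tau> j else j)" for j
    have "bij_betw \<rho> {..<n} {..<n}"
      using t(1) by (subst bij_betw_cong[of _ _ \<tau>]) (auto simp: \<rho>_def)
    hence "\<rho> permutes {..<n}" by (rule bij_imp_permutes) (simp add: \<rho>_def)
    moreover have "restrict s {..<n} \<in> {..<n} \<rightarrow>\<^sub>E {-1, 1}" using t(2) by auto
    moreover have "M = f (\<rho>, restrict s {..<n})"
      unfolding f_def t(3) by (auto simp: \<rho>_def)
    ultimately show "M \<in> f ` S" unfolding S_def by blast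
  qed
  ultimately have "card (signed_perm_mats n) = card S" by (metis card_image)
  also have "\<dots> = 2 ^ n * fact n"
    by (simp add: S_def card_cartesian_product card_permutations card_PiE numeral_2_eq_2)
  finally show ?thesis .
qed

text \<open>Swapping the arguments of a right action does not make it a left action, so the
  invariance of orbits is derived directly from \<open>act_mult\<close>.\<close>

lemma orbit_act:
  assumes P: "P \<in> gray_mats n" and M: "M \<in> carrier (signed_perm_group n)"
  shows "orbit (signed_perm_group n) (\<lambda>M P. act P M) (act P M) =
    orbit (signed_perm_group n) (\<lambda>M P. act P M) P"
proof -
  interpret G: group "signed_perm_group n" by (rule group_signed_perm_group)
  show ?thesis
  proof (intro equalityI subsetI)
    fix Q assume "Q \<in> orbit (signed_perm_group n) (\<lambda>M P. act P M) (act P M)"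
    then obtain N where N: "N \<in> carrier (signed_perm_group n)" and Q: "Q = act (act P M) N"
      by (auto simp: orbit_def)
    have "Q = act P (M \<otimes>\<^bsub>signed_perm_group n\<^esub> N)"
      using P M N Q by (simp add: act_mult)
    thus "Q \<in> orbit (signed_perm_group n) (\<lambda>M P. act P M) P"
      using G.m_closed[OF M N] by (auto simp: orbit_def)
  next
    fix Q assume "Q \<in> orbit (signed_perm_group n) (\<lambda>M P. act P M) P"
    then obtain N where N: "N \<in> carrier (signed_perm_group n)" and Q: "Q = act P N"
      by (auto simp: orbit_def)
    \<comment> \<open>To reach \<open>act P N\<close> from \<open>act P M\<close>, first undo
      \<open>M\<close>, then apply \<open>N\<close>.\<close>
    have MN: "inv\<^bsub>signed_perm_group n\<^esub> M \<otimes>\<^bsub>signed_perm_group n\<^esub> N \<in> carrier (signed_perm_group n)"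
      using M N by simp
    have "M \<otimes>\<^bsub>signed_perm_group n\<^esub> (inv\<^bsub>signed_perm_group n\<^esub> M \<otimes>\<^bsub>signed_perm_group n\<^esub> N) = N"
      using M N by (simp flip: G.m_assoc)
    hence "Q = act (act P M) (inv\<^bsub>signed_perm_group n\<^esub> M \<otimes>\<^bsub>signed_perm_group n\<^esub> N)"
      using act_mult[OF P M MN] Q by simp
    thus "Q \<in> orbit (signed_perm_group n) (\<lambda>M P. act P M) (act P M)"
      using MN by (auto simp: orbit_def)
  qed
qed

text \<open>By \<open>orbit_act\<close>, an orbit is generated by each of its points, so orbits
  sharing a point coincide; \<open>act_one\<close> gives covering and \<open>act_closed\<close>
  containment.\<close>

lemma partition_on_gray_orbits: "partition_on (gray_mats n) (gray_orbits n)"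
proof -
  interpret G: group "signed_perm_group n" by (rule group_signed_perm_group)
  let ?o = "orbit (signed_perm_group n) (\<lambda>M P. act P M)"
  have orb: "gray_orbits n = ?o ` gray_mats n"
    by (auto simp: gray_orbits_def orbits_def)
  have self: "P \<in> ?o P" if "P \<in> gray_mats n" for P
    using act_one[OF that] G.one_closed unfolding orbit_def by force
  have eq: "?o Q = ?o P" if "P \<in> gray_mats n" "Q \<in> ?o P" for P Q
    using that orbit_act by (auto simp: orbit_def[of _ _ P])
  have sub: "?o P \<subseteq> gray_mats n" if "P \<in> gray_mats n" for P
    using that act_closed by (auto simp: orbit_def)
  show ?thesis
    unfolding orb
  proof (rule partition_onI)
    show "\<Union> (?o ` gray_mats n) = gray_mats n" using self sub by blast
    show "disjnt p q" if "p \<in> ?o ` gray_mats n" "q \<in> ?o ` gray_mats n" "p \<noteq> q" for p q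
      using that eq unfolding disjnt_def by blast
    show "{} \<notin> ?o ` gray_mats n" using self by blast
  qed
qed

text \<open>The orbit of \<open>P\<close> is the image of the group under \<open>act P\<close>,
  which is injective because the action is free.\<close>

lemma card_gray_orbit:
  assumes "X \<in> gray_orbits n"
  shows "card X = order (signed_perm_group n)"
proof -
  obtain P where P: "P \<in> gray_mats n" and "X = orbit (signed_perm_group n) (\<lambda>M P. act P M) P"
    using assms by (auto simp: gray_orbits_def orbits_def)
  hence "X = act P ` signed_perm_mats n"
    by (auto simp: orbit_def signed_perm_group_def)
  moreover have "inj_on (act P) (signed_perm_mats n)"
    using P by (intro act_inj_on) (simp add: gray_mats_def)
  ultimately show ?thesis
    by (simp add: card_image order_def signed_perm_group_def)
qed

theorem theorem2:
  fixes n :: nat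
  assumes "n \<ge> 1"
  shows "partition_on (gray_mats n) (gray_orbits n) \<and>
    (\<forall>X \<in> gray_orbits n. card X = order (signed_perm_group n)) \<and>
    order (signed_perm_group n) = 2 ^ n * fact n \<and>
    real (card (gray_orbits n)) = real (card (gray_mats n)) / (2 ^ n * fact n)"
proof -
  have ord: "order (signed_perm_group n) = 2 ^ n * fact n"
    by (simp add: order_def signed_perm_group_def card_signed_perm_mats)
  note part = partition_on_gray_orbits[of n]
  have fin: "finite (gray_mats n)"
    by (rule finite_subset[OF _ finite_preference_mats[of n]]) (auto simp: gray_mats_def)
  \<comment> \<open>Count the disjoint union of equally large blocks.\<close>
  have "2 ^ n * fact n * card (gray_orbits n) = card (\<Union> (gray_orbits n))"
  proof (rule card_partition)
    show "finite (gray_orbits n)" using fin part by (rule finite_elements)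
    show "finite (\<Union> (gray_orbits n))" using fin part by (simp add: partition_on_def)
    show "card X = 2 ^ n * fact n" if "X \<in> gray_orbits n" for X
      using card_gray_orbit[OF that] ord by simp
    show "X \<inter> Y = {}" if "X \<in> gray_orbits n" "Y \<in> gray_orbits n" "X \<noteq> Y" for X Y
      using part that by (auto simp: partition_on_def disjoint_def)
  qed
  also have "\<Union> (gray_orbits n) = gray_mats n" using part by (simp add: partition_on_def)
  \<comment> \<open>The passage to reals makes the quotient exact, where division on
    \<open>nat\<close> could hide a remainder.\<close>
  finally have "2 ^ n * fact n * real (card (gray_orbits n)) = real (card (gray_mats n))"
    by (metis of_nat_fact of_nat_mult of_nat_numeral of_nat_power)
  hence "real (card (gray_orbits n)) = real (card (gray_mats n)) / (2 ^ n * fact n)"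
    by (simp add: field_simps)
  thus ?thesis using part card_gray_orbit ord by blast
qed

end
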